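(* Assume the generalized Riemann hypothesis. Let $n\ge 2$ be an integer. A prime $p_n\equiv 1\pmod n$ with $p_n<2(n\log n)^2$ can be found in $\mathcal{O}\left(n(\log n)^2\log\log n\right)$ time.
   Context: $\log$ is the natural logarithm. Computational model: arithmetic operations on integers with $\mathcal{O}(\log n)$ bits take constant time. The run-time bound is asymptotic as $n\to\infty$. Known fact that may be assumed: under the generalized Riemann hypothesis, for each $n\ge 2$ and $r$ with $\gcd(n,r)=1$ there is a prime congruent to $r$ modulo $n$ that is less than $2(n\log n)^2$ (Bach–Sorenson). *)

theory Defs
  imports
    "HOL-Complex_Analysis.Complex_Analysis"
    "HOL-Number_Theory.Cong"
    "HOL-Library.Landau_Symbols"
begin

section \<open>The generalized Riemann hypothesis\<close>

definition dirichlet_character :: "nat \<Rightarrow> (nat \<Rightarrow> complex) \<Rightarrow> bool" where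
  "dirichlet_character q chi \<longleftrightarrow> q > 0 \<and>
     (\<forall>a b. chi (a * b) = chi a * chi b) \<and>
     (\<forall>a. chi (a + q) = chi a) \<and>
     (\<forall>a. chi a \<noteq> 0 \<longleftrightarrow> coprime a q)"

text \<open>
  The point 1 is removed from the domain because of the pole of the L-function of
  a principal character; the value of L at 1 is left unspecified for every character.
\<close>

definition is_dirichlet_L :: "(nat \<Rightarrow> complex) \<Rightarrow> (complex \<Rightarrow> complex) \<Rightarrow> bool" where
  "is_dirichlet_L chi L \<longleftrightarrow> L holomorphic_on (UNIV - {1}) \<and>
     (\<forall>s. Re s > 1 \<longrightarrow> (\<lambda>k. chi (Suc k) / of_nat (Suc k) powr s) sums L s)"

lemma is_dirichlet_L_unique:
  assumes "is_dirichlet_L chi L" and "is_dirichlet_L chi L'" and "s \<noteq> 1"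
  shows "L s = L' s"
proof (rule analytic_continuation_open[where f = L and g = L' and s = "{z. Re z > 1}" and s' = "UNIV - {1}"])
  show "open {z. Re z > 1}" by (rule open_halfspace_Re_gt)
  show "{z::complex. Re z > 1} \<noteq> {}" by (auto intro: exI[of _ 2])
  show "connected (UNIV - {1::complex})"
    using connected_punctured_universe[of "1::complex"] by (simp add: Compl_eq_Diff_UNIV)
  show "L z = L' z" if "z \<in> {z. Re z > 1}" for z
    using that assms(1,2) unfolding is_dirichlet_L_def by (blast intro: sums_unique2)
qed (use assms in \<open>auto simp: is_dirichlet_L_def\<close>)

text \<open>
  Every Dirichlet L-series has such a continuation, by a classical theorem; by the lemma above
  it is unique away from 1, so the choice below is immaterial.
\<close>

definition dirichlet_L :: "(nat \<Rightarrow> complex) \<Rightarrow> complex \<Rightarrow> complex" where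
  "dirichlet_L chi = (SOME L. is_dirichlet_L chi L)"

text \<open>
  Principal and imprimitive characters are included. The strip is open, which excludes the zeros
  of imprimitive L-functions on the imaginary axis.
\<close>

definition generalized_riemann_hypothesis :: bool where
  "generalized_riemann_hypothesis \<longleftrightarrow>
     (\<forall>q chi s. dirichlet_character q chi \<longrightarrow> 0 < Re s \<longrightarrow> Re s < 1 \<longrightarrow> dirichlet_L chi s = 0
        \<longrightarrow> Re s = 1 / 2)"


section \<open>A random access machine with words of bounded length\<close>

text \<open>
  A program addresses finitely many registers directly, and a memory indirectly. Each arithmetic
  operation, comparison and memory access costs one time unit, but a run is stuck
  as soon as it uses or produces an integer that does not fit into a word.
  Memory addresses are arbitrary integers, and all cells are initially zero.
\<close>

datatype operand = Const int | Reg nat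

datatype arith = ADD | SUB | MUL | DIV | MOD

datatype test = Less operand operand | Equal operand operand

datatype com =
    SKIP
  | Arith nat arith operand operand
  | Load nat operand
  | Store operand operand
  | Seq com com
  | IF test com com
  | WHILE test com

type_synonym state = "(nat \<Rightarrow> int) \<times> (int \<Rightarrow> int)"

fun val :: "state \<Rightarrow> operand \<Rightarrow> int" where
  "val s (Const k) = k"
| "val s (Reg x) = fst s x"

fun apply_arith :: "arith \<Rightarrow> int \<Rightarrow> int \<Rightarrow> int" where
  "apply_arith ADD a b = a + b"
| "apply_arith SUB a b = a - b"
| "apply_arith MUL a b = a * b"
| "apply_arith DIV a b = a div b"
| "apply_arith MOD a b = a mod b"

fun holds :: "state \<Rightarrow> test \<Rightarrow> bool" where
  "holds s (Less a b) \<longleftrightarrow> val s a < val s b"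
| "holds s (Equal a b) \<longleftrightarrow> val s a = val s b"

definition fits :: "nat \<Rightarrow> int \<Rightarrow> bool" where
  "fits w k \<longleftrightarrow> \<bar>k\<bar> < 2 ^ w"

fun test_fits :: "nat \<Rightarrow> state \<Rightarrow> test \<Rightarrow> bool" where
  "test_fits w s (Less a b) \<longleftrightarrow> fits w (val s a) \<and> fits w (val s b)"
| "test_fits w s (Equal a b) \<longleftrightarrow> fits w (val s a) \<and> fits w (val s b)"

text \<open>
  \<open>exec w P s t s'\<close>: with words of \<open>w\<close> bits (and a sign), \<open>P\<close> started in \<open>s\<close> halts
  in \<open>s'\<close> after exactly \<open>t\<close> time units. Division by zero is stuck.
\<close>

inductive exec :: "nat \<Rightarrow> com \<Rightarrow> state \<Rightarrow> nat \<Rightarrow> state \<Rightarrow> bool" for w where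
  Skip: "exec w SKIP s 1 s"
| Arith: "fits w (val s a) \<Longrightarrow> fits w (val s b) \<Longrightarrow> (f \<in> {DIV, MOD} \<longrightarrow> val s b \<noteq> 0) \<Longrightarrow>
    fits w (apply_arith f (val s a) (val s b)) \<Longrightarrow>
    exec w (Arith x f a b) s 1 ((fst s)(x := apply_arith f (val s a) (val s b)), snd s)"
| Load: "fits w (val s a) \<Longrightarrow> fits w (snd s (val s a)) \<Longrightarrow>
    exec w (Load x a) s 1 ((fst s)(x := snd s (val s a)), snd s)"
| Store: "fits w (val s a) \<Longrightarrow> fits w (val s b) \<Longrightarrow>
    exec w (Store a b) s 1 (fst s, (snd s)(val s a := val s b))"
| Seq: "exec w c1 s t1 s' \<Longrightarrow> exec w c2 s' t2 s'' \<Longrightarrow> exec w (Seq c1 c2) s (t1 + t2) s''"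
| IfTrue: "test_fits w s b \<Longrightarrow> holds s b \<Longrightarrow> exec w c1 s t s' \<Longrightarrow> exec w (IF b c1 c2) s (1 + t) s'"
| IfFalse: "test_fits w s b \<Longrightarrow> \<not> holds s b \<Longrightarrow> exec w c2 s t s' \<Longrightarrow> exec w (IF b c1 c2) s (1 + t) s'"
| WhileFalse: "test_fits w s b \<Longrightarrow> \<not> holds s b \<Longrightarrow> exec w (WHILE b c) s 1 s"
| WhileTrue: "test_fits w s b \<Longrightarrow> holds s b \<Longrightarrow> exec w c s t1 s' \<Longrightarrow> exec w (WHILE b c) s' t2 s'' \<Longrightarrow>
    exec w (WHILE b c) s (1 + t1 + t2) s''"

inductive_cases exec_SKIP: "exec w SKIP s t s'"
inductive_cases exec_Arith: "exec w (Arith x f a b) s t s'"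
inductive_cases exec_Load: "exec w (Load x a) s t s'"
inductive_cases exec_Store: "exec w (Store a b) s t s'"
inductive_cases exec_Seq: "exec w (Seq c1 c2) s t s'"
inductive_cases exec_IF: "exec w (IF b c1 c2) s t s'"
inductive_cases exec_WHILE: "exec w (WHILE b c) s t s'"

lemma exec_deterministic:
  "exec w c s t s' \<Longrightarrow> exec w c s u s'' \<Longrightarrow> u = t \<and> s'' = s'"
proof (induction arbitrary: u s'' rule: exec.induct)
  case (Seq c1 s t1 s' c2 t2 s2)
  show ?case
    by (rule exec_Seq[OF Seq.prems]) (metis Seq.IH)
next
  case (IfTrue s b c1 t s' c2)
  show ?case
    by (rule exec_IF[OF IfTrue.prems]) (use IfTrue.hyps(2) in \<open>auto dest!: IfTrue.IH\<close>)
next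
  case (IfFalse s b c2 t s' c1)
  show ?case
    by (rule exec_IF[OF IfFalse.prems]) (use IfFalse.hyps(2) in \<open>auto dest!: IfFalse.IH\<close>)
next
  case (WhileFalse s b c)
  show ?case
    by (rule exec_WHILE[OF WhileFalse.prems]) (use WhileFalse.hyps(2) in simp_all)
next
  case (WhileTrue s b c t1 s' t2 s2)
  show ?case
    by (rule exec_WHILE[OF WhileTrue.prems]) (metis WhileTrue.IH WhileTrue.hyps(2) plus_1_eq_Suc add_Suc)+
qed (auto elim: exec_SKIP exec_Arith exec_Load exec_Store)

definition input :: "nat \<Rightarrow> state" where
  "input n = ((\<lambda>_. 0)(0 := int n), \<lambda>_. 0)"

definition result :: "state \<Rightarrow> int" where
  "result s = fst s 0"

text \<open>
  One program has to serve all inputs \<open>n\<close>; it has no access to the word length.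
\<close>

definition found_in_time :: "nat set \<Rightarrow> (nat \<Rightarrow> nat \<Rightarrow> bool) \<Rightarrow> (nat \<Rightarrow> real) \<Rightarrow> bool" where
  "found_in_time D R f \<longleftrightarrow> (\<exists>P wordlen time.
     (\<lambda>n. real (wordlen n)) \<in> O(\<lambda>n. ln (real n)) \<and>
     (\<lambda>n. real (time n)) \<in> O(f) \<and>
     (\<forall>n\<in>D. \<exists>s p. exec (wordlen n) P (input n) (time n) s \<and> result s = int p \<and> R n p))"

end

theory Submission
  imports
    Defs
    "HOL-Number_Theory.Residues"
    "HOL-Library.Log_Nat"
    "HOL-Real_Asymp.Real_Asymp"
begin

text \<open>
  Let \<open>L\<close> be the bit length of \<open>n\<close> and \<open>N = 2 n L\<close>, so that \<open>N\<^sup>2\<close> exceeds the Bach--Sorenson bound. For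
  each prime \<open>q < N\<close>, found by the sieve of Eratosthenes, the program also crosses out the multiples
  of \<open>q\<close> among the \<open>N\<^sup>2 / n = 4 n L\<^sup>2\<close> numbers \<open>1 + k n < N\<^sup>2\<close>. The first such multiple comes from an inverse of
  \<open>n\<close> modulo \<open>q\<close>, computed in \<open>O(log n)\<close> steps, which for all \<open>q\<close> together costs only \<open>O(n L\<^sup>2)\<close>. The
  crossing out costs \<open>O(n L\<^sup>2 \<Sum> 1/q)\<close>, and the sum of \<open>1/q\<close> over the primes \<open>q < N\<close> is \<open>O(log log N)\<close>: the
  primes between \<open>2^k\<close> and \<open>2^(k+1)\<close> all divide a central binomial coefficient, so that they contribute
  \<open>O(1/k)\<close>.
\<close>


section \<open>Sums of inverse primes\<close>

text \<open>Distinct primes are coprime, so their divisibilities multiply up.\<close>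

lemma prod_primes_dvd:
  fixes x :: nat
  assumes "finite A" "\<And>p. p \<in> A \<Longrightarrow> prime p \<and> p dvd x"
  shows "\<Prod>A dvd x"
  using assms
proof (induction A rule: finite_induct)
  case (insert p A)
  have "coprime p (\<Prod>A)"
    by (rule prod_coprime_right) (metis insert.hyps(2) insert.prems insertCI primes_coprime)
  with insert show ?case by (auto intro: divides_mult)
qed simp

text \<open>A prime p with m < p <= 2m divides (2m)!, which is m! * m! times the central binomial
  coefficient. It does not divide m!, so it divides the coefficient, and so does the product of all
  such primes.\<close>

lemma prod_primes_le_central_binomial:
  "\<Prod>{p. prime p \<and> m < p \<and> p \<le> 2 * m} \<le> (2 * m choose m)"
proof -
  have "p dvd (2 * m choose m)" if "prime p" "m < p" "p \<le> 2 * m" for p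
  proof -
    have "p dvd fact (2 * m)" using that by (simp add: prime_dvd_fact_iff)
    also have "fact (2 * m) = (fact m * fact m * (2 * m choose m) :: nat)"
      using binomial_fact_lemma[of m "2 * m"] by simp
    finally show ?thesis
      using that by (simp add: prime_dvd_mult_iff prime_dvd_fact_iff)
  qed
  then have "\<Prod>{p. prime p \<and> m < p \<and> p \<le> 2 * m} dvd (2 * m choose m)"
    by (intro prod_primes_dvd) auto
  then show ?thesis by (rule dvd_imp_le) simp
qed

text \<open>A bound of Chebyshev type. Each counted prime exceeds 2^k, so 2 to the power of the
  left-hand side is at most the product of these primes. That product is at most the central
  binomial coefficient for m = 2^k, hence at most 2^(2^(k+1)); then the exponents are
  compared.\<close>

lemma card_primes_dyadic:
  "k * card {p :: nat. prime p \<and> 2 ^ k < p \<and> p \<le> 2 ^ Suc k} \<le> 2 ^ Suc k"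
proof -
  let ?P = "{p :: nat. prime p \<and> 2 ^ k < p \<and> p \<le> 2 ^ Suc k}"
  have "(2 :: nat) ^ (k * card ?P) = (\<Prod>p\<in>?P. 2 ^ k)"
    by (simp add: power_mult)
  also have "\<dots> \<le> \<Prod>?P"
    by (intro prod_mono) auto
  also have "\<dots> \<le> (2 * 2 ^ k choose 2 ^ k)"
    using prod_primes_le_central_binomial[of "2 ^ k"] by simp
  also have "\<dots> \<le> 2 ^ (2 * 2 ^ k)"
    using binomial_le_pow2 by blast
  finally show ?thesis by simp
qed

text \<open>A weak form of Mertens' theorem. The induction adds one dyadic block of primes at a
  time. Block k has at most 4 * 2^k / (k+1) members, each contributing at most 1/2^k, so it adds at
  most four times the new harmonic term.\<close>

lemma sum_inverse_primes_le_harm: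
  "(\<Sum>p | prime p \<and> p \<le> 2 ^ J. 1 / real p) \<le> 4 * harm J"
proof (induction J)
  case 0
  have "{p :: nat. prime p \<and> p \<le> 2 ^ 0} = {}" by (auto dest: prime_ge_2_nat)
  then show ?case by (simp only: sum.empty) (simp add: harm_def)
next
  case (Suc k)
  define P where "P = {p :: nat. prime p \<and> 2 ^ k < p \<and> p \<le> 2 ^ Suc k}"
  have fin: "finite P" unfolding P_def by (rule finite_subset[of _ "{..2 ^ Suc k}"]) auto
  \<comment> \<open>Passing from k to k + 1 costs a factor 2 if k >= 1. For k = 0 the dyadic bound
    is void, but the block contains only the prime 2.\<close>
  have card: "card P * (k + 1) \<le> 4 * 2 ^ k"
  proof (cases "k = 0")
    case True
    have "P \<subseteq> {2}" using True by (auto simp: P_def)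
    then show ?thesis using True card_mono[of "{2 :: nat}" P] by simp
  next
    case False
    have "card P * (k + 1) \<le> card P * (2 * k)" using False by (intro mult_left_mono) auto
    also have "\<dots> \<le> 4 * 2 ^ k" using card_primes_dyadic[of k] by (simp add: P_def mult.commute)
    finally show ?thesis .
  qed
  have "{p :: nat. prime p \<and> p \<le> 2 ^ Suc k} = {p. prime p \<and> p \<le> 2 ^ k} \<union> P"
    unfolding P_def by auto
  then have "(\<Sum>p | prime p \<and> p \<le> 2 ^ Suc k. 1 / real p) =
      (\<Sum>p | prime p \<and> p \<le> 2 ^ k. 1 / real p) + (\<Sum>p\<in>P. 1 / real p)"
    using fin by (simp add: sum.union_disjoint disjoint_iff P_def)
  also have "(\<Sum>p\<in>P. 1 / real p) \<le> (\<Sum>p\<in>P. 1 / 2 ^ k)"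
  proof (intro sum_mono)
    fix p assume "p \<in> P"
    then have "2 ^ k \<le> p" by (simp add: P_def)
    then have "2 ^ k \<le> real p" by (metis of_nat_le_iff of_nat_numeral of_nat_power)
    moreover have "(0 :: real) < 2 ^ k" by simp
    ultimately show "1 / real p \<le> 1 / 2 ^ k" by (simp only: frac_le order_refl zero_le_one)
  qed
  also have "\<dots> \<le> 4 / real (Suc k)"
  proof -
    have "real (card P * (k + 1)) \<le> real (4 * 2 ^ k)"
      using card by (simp only: of_nat_le_iff)
    then show ?thesis by (simp add: divide_simps distrib_left)
  qed
  finally show ?case using Suc.IH by (simp add: harm_Suc divide_inverse distrib_left)
qed

lemma harm_le_ln: "1 \<le> n \<Longrightarrow> harm n \<le> 1 + ln (real n)"
  using euler_mascheroni_sequence_decreasing[of 1 n] by (simp add: harm_expand)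


section \<open>Timed weakest preconditions\<close>

text \<open>The postcondition also sees the elapsed time, which starts at \<open>t\<close>.\<close>

definition wp :: "nat \<Rightarrow> com \<Rightarrow> (nat \<Rightarrow> state \<Rightarrow> bool) \<Rightarrow> nat \<Rightarrow> state \<Rightarrow> bool" where
  "wp w c Q t s \<longleftrightarrow> (\<exists>u s'. exec w c s u s' \<and> Q (t + u) s')"

lemma wpI: "exec w c s u s' \<Longrightarrow> Q (t + u) s' \<Longrightarrow> wp w c Q t s"
  unfolding wp_def by blast

lemma wpE: "wp w c Q t s \<Longrightarrow> (\<And>u s'. exec w c s u s' \<Longrightarrow> Q (t + u) s' \<Longrightarrow> thesis) \<Longrightarrow> thesis"
  unfolding wp_def by blast

lemma wp_SKIP [simp]: "wp w SKIP Q t s \<longleftrightarrow> Q (Suc t) s"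
  by (auto elim!: wpE exec_SKIP intro!: wpI[OF exec.Skip])

lemma wp_Arith [simp]:
  "wp w (Arith x f a b) Q t s \<longleftrightarrow> fits w (val s a) \<and> fits w (val s b) \<and>
     (f \<in> {DIV, MOD} \<longrightarrow> val s b \<noteq> 0) \<and> fits w (apply_arith f (val s a) (val s b)) \<and>
     Q (Suc t) ((fst s)(x := apply_arith f (val s a) (val s b)), snd s)"
  by (auto elim!: wpE exec_Arith intro!: wpI[OF exec.Arith])

lemma wp_Load [simp]:
  "wp w (Load x a) Q t s \<longleftrightarrow> fits w (val s a) \<and> fits w (snd s (val s a)) \<and>
     Q (Suc t) ((fst s)(x := snd s (val s a)), snd s)"
  by (auto elim!: wpE exec_Load intro!: wpI[OF exec.Load])

lemma wp_Store [simp]: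
  "wp w (Store a b) Q t s \<longleftrightarrow> fits w (val s a) \<and> fits w (val s b) \<and>
     Q (Suc t) (fst s, (snd s)(val s a := val s b))"
  by (auto elim!: wpE exec_Store intro!: wpI[OF exec.Store])

lemma wp_Seq [simp]: "wp w (Seq c1 c2) Q t s \<longleftrightarrow> wp w c1 (wp w c2 Q) t s"
proof
  show "wp w (Seq c1 c2) Q t s \<Longrightarrow> wp w c1 (wp w c2 Q) t s"
    by (auto elim!: wpE exec_Seq intro!: wpI simp: add.assoc)
  show "wp w c1 (wp w c2 Q) t s \<Longrightarrow> wp w (Seq c1 c2) Q t s"
    by (auto elim!: wpE intro!: wpI exec.Seq simp: add.assoc)
qed

lemma wp_IF [simp]:
  "wp w (IF b c1 c2) Q t s \<longleftrightarrow>
     test_fits w s b \<and> (if holds s b then wp w c1 Q (Suc t) s else wp w c2 Q (Suc t) s)"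
  (is "?L = ?R")
proof
  show "?L \<Longrightarrow> ?R"
    by (auto elim!: wpE exec_IF intro!: wpI)
  show "?R \<Longrightarrow> ?L"
    by (auto elim!: wpE intro!: wpI exec.IfTrue exec.IfFalse split: if_splits)
qed

text \<open>Every evaluation of the test costs a time unit, so a time bound in the invariant implies
  termination.\<close>

lemma wp_WHILE:
  assumes "I t s"
    and fit: "\<And>t s. I t s \<Longrightarrow> test_fits w s b"
    and time: "\<And>t s. I t s \<Longrightarrow> t \<le> T"
    and step: "\<And>t s. I t s \<Longrightarrow> holds s b \<Longrightarrow> wp w c I (Suc t) s"
    and exit: "\<And>t s. I t s \<Longrightarrow> \<not> holds s b \<Longrightarrow> Q (Suc t) s"
  shows "wp w (WHILE b c) Q t s"
  using assms(1)
proof (induction "T - t" arbitrary: t s rule: less_induct)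
  case less
  show ?case
  proof (cases "holds s b")
    case True
    obtain u s' where u: "exec w c s u s'" "I (Suc t + u) s'"
      using step[OF less.prems True] unfolding wp_def by blast
    \<comment> \<open>The time bound is applied to the state after the body: it gives
      \<open>Suc t + u\<close> at most T, so the truncated difference really drops.\<close>
    have "T - (Suc t + u) < T - t"
      using time[OF u(2)] by linarith
    then obtain v s'' where v: "exec w (WHILE b c) s' v s''" "Q (Suc t + u + v) s''"
      using less.hyps[OF _ u(2)] unfolding wp_def by blast
    have "exec w (WHILE b c) s (1 + u + v) s''"
      using exec.WhileTrue[OF fit[OF less.prems] True u(1) v(1)] .
    with v(2) show ?thesis
      unfolding wp_def by (metis add.assoc add_Suc_right plus_1_eq_Suc add_Suc)
  next
    case False
    then show ?thesis
      using exec.WhileFalse[OF fit[OF less.prems] False, of c] exit[OF less.prems False]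
      unfolding wp_def by (metis add.commute plus_1_eq_Suc)
  qed
qed


section \<open>The two inner loops\<close>

text \<open>The crossing-out loop for both roles of the memory: it runs with step q and bound N, and
  with step q * n and bound N^2.\<close>

definition mark :: com where
  "mark = WHILE (Less (Reg 5) (Reg 7)) (Seq
     (Store (Reg 5) (Const 1))
     (Arith 5 ADD (Reg 5) (Reg 6)))"

text \<open>After k rounds exactly the cells c + i * d with i < k have been marked, the last of them
  below B, so there are at most B div d + 1 rounds of 3 time units, followed by one failing test.
  The bound on c keeps register 5 at most B + d even if no round takes place.\<close>

lemma wp_mark:
  assumes R: "R 5 = c" "R 6 = d" "R 7 = B"
    and c: "0 \<le> c" "c \<le> B + d" and d: "0 < d" and B: "0 \<le> B"
    and V: "B + d \<le> V" "V < 2 ^ w"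
    and Q: "\<And>t' x. t' \<le> t + 3 * nat (B div d) + 4 \<Longrightarrow>
      Q t' (R(5 := x), \<lambda>a. if c \<le> a \<and> d dvd a - c \<and> a < B then 1 else m a)"
  shows "wp w mark Q t (R, m)"
proof -
  define S where "S k = (R(5 := c + int k * d), \<lambda>a. if \<exists>i<k. a = c + int i * d then 1 else m a)" for k
  define I where "I t' s \<longleftrightarrow> (\<exists>k. s = S k \<and> t' = t + 3 * k \<and> (k > 0 \<longrightarrow> c + (int k - 1) * d < B))" for t' s
  have fit: "fits w x" if "\<bar>x\<bar> \<le> V" for x
    using that V unfolding fits_def by linarith
  have kB: "k \<le> nat (B div d) + 1" if "k > 0 \<longrightarrow> c + (int k - 1) * d < B" for k
  proof (cases "k > 0")
    case True
    with that c have "(int k - 1) * d \<le> B" by simp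
    then have "int k - 1 \<le> B div d"
      using d zdiv_mono1[of "(int k - 1) * d" B d] by simp
    then show ?thesis by linarith
  qed simp
  have pos: "\<bar>c + int k * d\<bar> \<le> V" if "k > 0 \<longrightarrow> c + (int k - 1) * d < B" for k
  proof (cases "k > 0")
    case True
    with that have "c + int k * d < B + d" by (simp add: algebra_simps)
    moreover have "0 \<le> c + int k * d" using c d by simp
    ultimately show ?thesis using V by linarith
  next
    case False then show ?thesis using c V by simp
  qed
  show ?thesis
    unfolding mark_def
  proof (rule wp_WHILE[where I = I and T = "t + 3 * (nat (B div d) + 1)"])
    show "I t (R, m)"
      unfolding I_def S_def using R(1) by (intro exI[of _ 0]) auto
  next
    fix t' s assume "I t' s"
    then obtain k where k: "s = S k" "t' = t + 3 * k" "k > 0 \<longrightarrow> c + (int k - 1) * d < B"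
      unfolding I_def by blast
    have "fits w (c + int k * d)" "fits w B"
      using pos[OF k(3)] V B d by (auto intro!: fit)
    then show "test_fits w s (Less (Reg 5) (Reg 7))"
      using R(3) by (simp add: k(1) S_def)
    show "t' \<le> t + 3 * (nat (B div d) + 1)"
      using k(2) kB[OF k(3)] by simp
    { assume "holds s (Less (Reg 5) (Reg 7))"
      then have lt: "c + int k * d < B" using R(3) by (simp add: k(1) S_def)
      have fits: "fits w (c + int k * d)" "fits w 1" "fits w d" "fits w (c + int k * d + d)"
        using pos[OF k(3)] pos[of "Suc k"] lt V B d by (auto intro!: fit simp: algebra_simps)
      have upd: "(R(5 := c + int k * d + d), (\<lambda>a. if \<exists>i<k. a = c + int i * d then 1 else m a)(c + int k * d := 1)) = S (Suc k)"
        unfolding S_def by (auto simp: fun_eq_iff algebra_simps less_Suc_eq)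
      have "I (Suc (Suc (Suc t'))) (S (Suc k))"
        unfolding I_def using k(2) lt by (intro exI[of _ "Suc k"]) auto
      then show "wp w (Seq (Store (Reg 5) (Const 1)) (Arith 5 ADD (Reg 5) (Reg 6))) I (Suc t') s"
        using fits R(2) upd by (simp add: k(1) S_def) }
    { assume "\<not> holds s (Less (Reg 5) (Reg 7))"
      then have ge: "c + int k * d \<ge> B" using R(3) by (simp add: k(1) S_def)
      \<comment> \<open>On exit c + k * d is at least B, whereas all marked cells lie below B. Hence
        i < k amounts to c + i * d < B, and the marked set no longer depends on k.\<close>
      have eq: "(\<exists>i<k. a = c + int i * d) \<longleftrightarrow> c \<le> a \<and> d dvd a - c \<and> a < B" for a
      proof
        assume "\<exists>i<k. a = c + int i * d"
        then obtain i where i: "i < k" "a = c + int i * d" by blast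
        have "int i * d \<le> (int k - 1) * d" using i(1) d by (intro mult_right_mono) auto
        moreover have "c + (int k - 1) * d < B" using k(3) i(1) by simp
        ultimately have "c + int i * d < B" by linarith
        then show "c \<le> a \<and> d dvd a - c \<and> a < B" using i d by auto
      next
        assume a: "c \<le> a \<and> d dvd a - c \<and> a < B"
        then obtain j where j: "a - c = d * j" by blast
        with a d have "j \<ge> 0" by (metis diff_ge_0_iff_ge zero_le_mult_iff not_le)
        have "j * d < int k * d" using a ge j by (simp add: mult.commute)
        then have "j < int k" using d by (simp add: mult_less_cancel_right)
        then show "\<exists>i<k. a = c + int i * d"
          using j \<open>j \<ge> 0\<close> by (intro exI[of _ "nat j"]) (auto simp: mult.commute)
      qed
      show "Q (Suc t') s"
        unfolding k(1) S_def eq using k(2) kB[OF k(3)] by (intro Q) simp }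
  qed
qed

text \<open>Binary exponentiation modulo register 3: register 8 accumulates the power, 9 holds the
  repeated square, 10 the remaining exponent and 11 its lowest bit. Reducing after every product
  keeps all values below q^2.\<close>

definition power_loop :: com where
  "power_loop = WHILE (Less (Const 0) (Reg 10)) (Seq
     (Arith 11 MOD (Reg 10) (Const 2)) (Seq
     (IF (Equal (Reg 11) (Const 1)) (Seq (Arith 8 MUL (Reg 8) (Reg 9)) (Arith 8 MOD (Reg 8) (Reg 3))) SKIP) (Seq
     (Arith 9 MUL (Reg 9) (Reg 9)) (Seq
     (Arith 9 MOD (Reg 9) (Reg 3))
     (Arith 10 DIV (Reg 10) (Const 2))))))"

text \<open>The invariant is that r * x^y stays congruent to b^e, where r, x, y are the contents of
  registers 8, 9, 10. At the end y = 0 and r is the power.\<close>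

lemma wp_power_loop:
  assumes R: "R 3 = q" "R 8 = 1" "R 9 = b" "R 10 = int e"
    and b: "0 \<le> b" "b < q" "1 < q" and e: "int e < q" "e < 2 ^ j"
    and V: "q * q \<le> V" "V < 2 ^ w"
    and Q: "\<And>t' r x y z. t' \<le> t + 8 * j + 1 \<Longrightarrow> 0 \<le> r \<Longrightarrow> r < q \<Longrightarrow> [r = b ^ e] (mod q) \<Longrightarrow>
      Q t' (R(8 := r, 9 := x, 10 := y, 11 := z), m)"
  shows "wp w power_loop Q t (R, m)"
proof -
  define S where "S r x y z = (R(8 := r, 9 := x, 10 := int y, 11 := z), m)" for r x y z
  \<comment> \<open>Here i bounds the bit length of the remaining exponent y. Each round lowers i by
    one and may spend 8 time units in return.\<close>
  define I where "I t' s \<longleftrightarrow> (\<exists>r x y z i. s = S r x y z \<and> t' + 8 * i \<le> t + 8 * j \<and> y < 2 ^ i \<and>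
    0 \<le> r \<and> r < q \<and> 0 \<le> x \<and> x < q \<and> int y < q \<and> [r * x ^ y = b ^ e] (mod q))" for t' s
  have fit: "fits w x" if "\<bar>x\<bar> \<le> V" for x
    using that V unfolding fits_def by linarith
  have qq: "q \<le> q * q" "2 * q \<le> q * q" using b by auto
  have fq: "fits w x" if "0 \<le> x" "x \<le> q" for x
    using that qq V by (intro fit) auto
  have fmod: "fits w (x mod q)" for x
    using b by (intro fq) (auto intro: less_imp_le)
  have fqq: "fits w (x * y)" if "0 \<le> x" "x < q" "0 \<le> y" "y < q" for x y
    using that V mult_mono[of x q y q] by (intro fit) auto
  show ?thesis
    unfolding power_loop_def
  proof (rule wp_WHILE[where I = I and T = "t + 8 * j"])
    have "(R, m) = S 1 b e (R 11)" unfolding S_def using R by (auto simp: fun_eq_iff)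
    then show "I t (R, m)"
      unfolding I_def using b e by (intro exI[of _ 1] exI[of _ b] exI[of _ e] exI[of _ "R 11"] exI[of _ j]) auto
  next
    fix t' s assume "I t' s"
    then obtain r x y z i where k: "s = S r x y z" "t' + 8 * i \<le> t + 8 * j" "y < 2 ^ i"
      "0 \<le> r" "r < q" "0 \<le> x" "x < q" "int y < q" "[r * x ^ y = b ^ e] (mod q)"
      unfolding I_def by blast
    show "test_fits w s (Less (Const 0) (Reg 10))"
      using k b by (auto simp: S_def intro!: fq)
    show "t' \<le> t + 8 * j" using k(2) by simp
    { assume "holds s (Less (Const 0) (Reg 10))"
      then have y: "y > 0" by (simp add: k(1) S_def)
      with k(3) obtain i' where i: "i = Suc i'" by (cases i) auto
      define r' where "r' = (if odd y then (r * x) mod q else r)"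
      define x' where "x' = (x * x) mod q"
      have "[r' * x' ^ (y div 2) = r * x ^ y] (mod q)"
      proof -
        have 1: "[x' ^ (y div 2) = (x * x) ^ (y div 2)] (mod q)"
          unfolding x'_def by (intro cong_pow) (simp add: cong_def)
        have 2: "[r' = (if odd y then r * x else r)] (mod q)"
          unfolding r'_def by (simp add: cong_def)
        have "(if odd y then r * x else r) * (x * x) ^ (y div 2) = r * x ^ y"
        proof (cases "odd y")
          case True
          then obtain l where "y = 2 * l + 1" by (auto elim: oddE)
          then show ?thesis by (simp add: power_mult power2_eq_square)
        next
          case False
          then obtain l where "y = 2 * l" by (auto elim: evenE)
          then show ?thesis by (simp add: power_mult power2_eq_square)
        qed
        with cong_mult[OF 2 1] show ?thesis by simp
      qed
      then have cong: "[r' * x' ^ (y div 2) = b ^ e] (mod q)" using k(9) cong_trans by blast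
      have bnd: "0 \<le> r'" "r' < q" "0 \<le> x'" "x' < q"
        using k b by (auto simp: r'_def x'_def)
      have bnd': "0 \<le> (r * x) mod q" "(r * x) mod q < q" "0 \<le> (x * x) mod q" "(x * x) mod q < q"
        using b by auto
      have fits: "fits w r" "fits w x" "fits w q" "fits w 0" "fits w 1" "fits w 2" "fits w (int y)"
        "fits w (int y mod 2)" "fits w (int y div 2)" "fits w (r * x)" "fits w (x * x)"
        "fits w ((r * x) mod q)" "fits w ((x * x) mod q)"
        using k b bnd' by (simp_all add: fq fqq fmod)
      have Inv: "I t'' (S r' x' (y div 2) z')" if "t'' \<le> t' + 8" for t'' z'
        unfolding I_def
      proof (rule exI[of _ r'], rule exI[of _ x'], rule exI[of _ "y div 2"], rule exI[of _ z'],
          rule exI[of _ i'], intro conjI)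
        show "t'' + 8 * i' \<le> t + 8 * j" using that k(2) i by simp
        show "y div 2 < 2 ^ i'" using k(3) i by simp
        show "int (y div 2) < q" using k(8) by linarith
      qed (use bnd cong in auto)
      have upd: "S r' x' (y div 2) z' = (R(11 := z', 8 := r', 9 := x', 10 := int y div 2), m)" for z'
        unfolding S_def by (auto simp: fun_eq_iff zdiv_int)
      have odd: "int y mod 2 = 1 \<longleftrightarrow> odd y" by presburger
      show "wp w (Seq
       (Arith 11 MOD (Reg 10) (Const 2)) (Seq
       (IF (Equal (Reg 11) (Const 1)) (Seq (Arith 8 MUL (Reg 8) (Reg 9)) (Arith 8 MOD (Reg 8) (Reg 3))) SKIP) (Seq
       (Arith 9 MUL (Reg 9) (Reg 9)) (Seq
       (Arith 9 MOD (Reg 9) (Reg 3))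
       (Arith 10 DIV (Reg 10) (Const 2)))))) I (Suc t') s"
      proof (cases "odd y")
        case True
        \<comment> \<open>With an odd exponent the round takes 8 units including the loop test; with
          an even one \<open>SKIP\<close> replaces two instructions and 7 suffice.\<close>
        have "I (t' + 8) (S r' x' (y div 2) (int y mod 2))" by (rule Inv) simp
        then show ?thesis
          using fits R b True unfolding upd
          by (simp add: k(1) S_def odd r'_def x'_def fun_upd_twist numeral_eq_Suc)
      next
        case False
        have "I (t' + 7) (S r' x' (y div 2) (int y mod 2))" by (rule Inv) simp
        then show ?thesis
          using fits R b False unfolding upd
          by (simp add: k(1) S_def odd r'_def x'_def fun_upd_twist numeral_eq_Suc)
      qed }
    { assume "\<not> holds s (Less (Const 0) (Reg 10))"
      then have "y = 0" by (simp add: k(1) S_def)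
      then show "Q (Suc t') s"
        using k unfolding k(1) S_def by (intro Q) auto }
  qed
qed


section \<open>The sieve\<close>

text \<open>
  Cells \<open>a < N\<close> serve the sieve of Eratosthenes that produces the sieving primes, cells
  \<open>a \<equiv> 1 (mod n)\<close> with \<open>a < N\<^sup>2\<close> the search for the wanted prime. A marked cell is composite in
  both roles, so the two sieves can share one memory.
\<close>

definition sieved :: "nat \<Rightarrow> nat \<Rightarrow> nat \<Rightarrow> int \<Rightarrow> bool" where
  "sieved n N q a \<longleftrightarrow> (\<exists>p<q. prime p \<and> int p dvd a \<and> int p < a) \<and>
     (a < int N \<or> a < int N * int N \<and> [a = 1] (mod int n))"

definition sieve_memory :: "nat \<Rightarrow> nat \<Rightarrow> nat \<Rightarrow> int \<Rightarrow> int" where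
  "sieve_memory n N q = (\<lambda>a. if sieved n N q a then 1 else 0)"

lemma sieved_Suc_prime:
  assumes "prime q"
  shows "sieved n N (Suc q) a \<longleftrightarrow> sieved n N q a \<or> int q dvd a \<and> int q < a \<and>
     (a < int N \<or> a < int N * int N \<and> [a = 1] (mod int n))"
  using assms unfolding sieved_def by (auto simp: less_Suc_eq)

lemma sieve_memory_Suc_not_prime:
  assumes "\<not> prime q"
  shows "sieve_memory n N (Suc q) = sieve_memory n N q"
  using assms unfolding sieve_memory_def sieved_def by (auto simp: less_Suc_eq fun_eq_iff)

text \<open>When the sieve reaches q, the cell of q already decides whether q is prime: a composite
  q has a prime factor below q.\<close>

lemma sieved_self:
  assumes "2 \<le> q" "q < N"
  shows "sieved n N q (int q) \<longleftrightarrow> \<not> prime q"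
proof
  assume "sieved n N q (int q)"
  then obtain p where "p < q" "prime p" "p dvd q" unfolding sieved_def by auto
  then show "\<not> prime q" by (metis prime_nat_iff less_irrefl)
next
  assume "\<not> prime q"
  obtain p where p: "prime p" "p dvd q" using assms prime_factor_nat[of q] by auto
  with \<open>\<not> prime q\<close> have "p \<noteq> q" by auto
  with p assms have "p < q" by (metis dvd_imp_le le_neq_implies_less less_le_trans zero_less_numeral)
  with p assms show "sieved n N q (int q)" unfolding sieved_def by auto
qed

text \<open>Sieving by the primes below N decides primality up to N^2: if a = b * c is composite and
  d is the smaller factor, then d^2 <= a < N^2, so every prime divisor of d is below N.\<close>

lemma sieved_square:
  assumes "2 \<le> a" "a < N * N" "[a = 1] (mod n)" "N \<le> q"
  shows "sieved n N q (int a) \<longleftrightarrow> \<not> prime a"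
proof
  assume "sieved n N q (int a)"
  then obtain p where "p < a" "prime p" "p dvd a" unfolding sieved_def by auto
  then show "\<not> prime a" by (metis prime_nat_iff less_irrefl)
next
  assume "\<not> prime a"
  with assms(1) obtain b c where bc: "a = b * c" "b \<noteq> 1" "c \<noteq> 1"
    by (metis dvdE mult.right_neutral numeral_2_eq_2 prime_nat_iff One_nat_def
        one_less_numeral_iff semiring_norm(76) order_less_le_trans)
  define d where "d = min b c"
  have d: "d dvd a" "d \<noteq> 1" "d * d \<le> a"
    using bc by (auto simp: d_def min_def intro: mult_le_mono)
  obtain p where p: "prime p" "p dvd d" using prime_factor_nat[OF d(2)] by blast
  have "d > 0" using d(1) assms(1) by (intro Nat.gr0I) auto
  then have "p \<le> d" using p by (auto dest: dvd_imp_le)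
  then have "p * p \<le> a" using d(3) mult_le_mono[of p d p d] by linarith
  then have "p * p < N * N" using assms(2) by linarith
  then have "p < N" by (meson mult_le_mono not_le)
  have "p < p * p" using prime_gt_1_nat[OF p(1)] by simp
  with \<open>p * p \<le> a\<close> have "p < a" by linarith
  moreover have "p dvd a" using p(2) d(1) dvd_trans by blast
  moreover have "int a < int N * int N" using assms(2) by (metis of_nat_less_iff of_nat_mult)
  moreover have "[int a = 1] (mod int n)" using assms(3) cong_int_iff[of a 1 n] by simp
  ultimately show "sieved n N q (int a)"
    unfolding sieved_def using p(1) \<open>p < N\<close> assms(4) by (intro conjI exI[of _ p]) auto
qed

text \<open>By Fermat, \<open>r = n ^ (q - 2)\<close> is an inverse of \<open>n\<close> modulo \<open>q\<close>. If \<open>q\<close> divides \<open>n\<close>, the value of \<open>c\<close> is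
  useless, which the program detects by testing whether \<open>q\<close> divides \<open>c\<close>.\<close>

lemma first_multiple:
  fixes n q :: nat and r :: int
  assumes q: "prime q" and n: "1 \<le> n" and r: "[r = (int n mod int q) ^ (q - 2)] (mod int q)"
  defines "c \<equiv> (- r) mod int q * int n + 1"
  shows "0 < c" "c \<le> int q * int n" "[c = 1] (mod int n)" "int q dvd c \<longleftrightarrow> \<not> q dvd n"
proof -
  have q1: "q > 1" using q by (rule prime_gt_1_nat)
  have m: "0 \<le> (- r) mod int q" "(- r) mod int q \<le> int q - 1"
    using q1 pos_mod_bound[of "int q" "-r"] by auto
  then show "0 < c" unfolding c_def by (simp add: add_nonneg_pos)
  have "(- r) mod int q * int n \<le> (int q - 1) * int n" using m by (intro mult_right_mono) auto
  then show "c \<le> int q * int n" unfolding c_def using n by (simp add: algebra_simps)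
  show "[c = 1] (mod int n)" unfolding c_def by (simp add: cong_def)
  show "int q dvd c \<longleftrightarrow> \<not> q dvd n"
  proof (cases "q dvd n")
    case True
    then have "[c = 1] (mod int q)" unfolding c_def cong_iff_dvd_diff by simp
    then have "int q dvd c \<longleftrightarrow> int q dvd 1" by (rule cong_dvd_iff)
    with True q1 show ?thesis by auto
  next
    case False
    have "[(int n) ^ (q - 2) = (int n mod int q) ^ (q - 2)] (mod int q)"
      by (intro cong_pow) (simp add: cong_def)
    then have r': "[r = (int n) ^ (q - 2)] (mod int q)" using r cong_sym cong_trans by blast
    \<comment> \<open>Modulo q, c is 1 - r * n, hence 1 - n^(q - 1), which vanishes by
      Fermat.\<close>
    have "[c = (- r) * int n + 1] (mod int q)"
      unfolding c_def by (intro cong_add cong_mult) (auto simp: cong_def)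
    also have "[(- r) * int n + 1 = - (int n ^ (q - 2)) * int n + 1] (mod int q)"
      using r' by (intro cong_add cong_mult) (auto simp: cong_minus_minus_iff)
    also have "- (int n ^ (q - 2)) * int n + 1 = 1 - int (n ^ (q - 1))"
    proof -
      have "q - 1 = Suc (q - 2)" using q1 by simp
      then show ?thesis by (simp add: mult.commute)
    qed
    also have "[1 - int (n ^ (q - 1)) = 1 - 1] (mod int q)"
      using fermat_theorem[OF q False] by (intro cong_diff) (auto simp flip: cong_int_iff)
    finally show ?thesis using False by (simp add: cong_0_iff)
  qed
qed

text \<open>By coprimality of q and n, the conditions on a single out one residue class modulo q *
  n, as in the Chinese remainder theorem. Since c lies in this class and between 1 and q * n, it is
  the least positive member.\<close>

lemma progression_multiples:
  fixes n q :: nat and c :: int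
  assumes q: "prime q" "\<not> q dvd n"
    and c: "0 < c" "c \<le> int q * int n" "[c = 1] (mod int n)" "int q dvd c"
  shows "c \<le> a \<and> int q * int n dvd a - c \<longleftrightarrow> 0 < a \<and> int q dvd a \<and> [a = 1] (mod int n)"
proof -
  have cop: "coprime (int q) (int n)" using q prime_imp_coprime by auto
  have "int q * int n dvd a - c \<longleftrightarrow> int q dvd a - c \<and> int n dvd a - c"
    using cop by (meson divides_mult dvd_mult_left dvd_mult_right)
  also have "int q dvd a - c \<longleftrightarrow> int q dvd a" using c(4) 
    by (metis dvd_add_left_iff diff_add_cancel)
  also have "int n dvd a - c \<longleftrightarrow> [a = 1] (mod int n)"
    using c(3) by (metis cong_iff_dvd_diff cong_sym cong_trans)
  finally have *: "int q * int n dvd a - c \<longleftrightarrow> int q dvd a \<and> [a = 1] (mod int n)" .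
  have "c \<le> a" if "0 < a" "int q * int n dvd a - c"
  proof (rule ccontr)
    assume "\<not> c \<le> a"
    then have "int q * int n dvd c - a" "c - a > 0" using that(2) by (auto simp: dvd_diff_commute)
    then have "int q * int n \<le> c - a" by (rule zdvd_imp_le)
    with that c show False by simp
  qed
  with * c show ?thesis by auto
qed

text \<open>Justifies skipping the second pass for primes q that divide n: no candidate is a
  multiple of such a q.\<close>

lemma not_cong_1_of_dvd:
  fixes n q :: nat and a :: int
  assumes "prime q" "q dvd n" "int q dvd a"
  shows "\<not> [a = 1] (mod int n)"
proof
  assume "[a = 1] (mod int n)"
  with assms(2) have "[a = 1] (mod int q)" by (meson cong_dvd_modulus of_nat_dvd_iff)
  then have "int q dvd 1" using assms(3) cong_dvd_iff by blast
  with assms(1) show False by simp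
qed

section \<open>The sieve as a program, with time bounds\<close>

lemma add_numeral_Suc:
  "t + 3 = Suc (Suc (Suc t))" "t + 4 = Suc (Suc (Suc (Suc t)))" for t :: nat
  by simp_all

text \<open>
  Registers: 0 holds \<open>n\<close>, 12 holds \<open>N\<close>, 2 holds \<open>N\<^sup>2\<close>, 3 the current \<open>q\<close>; 5, 6, 7 are start, step
  and bound of the marking loop; 8, 9, 10, 11 belong to the modular exponentiation.
\<close>

definition first_multiple_com :: com where
  "first_multiple_com = Seq
     (Arith 8 ADD (Const 1) (Const 0)) (Seq
     (Arith 9 MOD (Reg 0) (Reg 3)) (Seq
     (Arith 10 SUB (Reg 3) (Const 2)) (Seq
     power_loop (Seq
     (Arith 5 SUB (Const 0) (Reg 8)) (Seq
     (Arith 5 MOD (Reg 5) (Reg 3)) (Seq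
     (Arith 5 MUL (Reg 5) (Reg 0))
     (Arith 5 ADD (Reg 5) (Const 1))))))))"

text \<open>The 8 consists of seven assignments and the last test of \<open>power_loop\<close>. In
  the bound on V, q * q serves the exponentiation, the other terms the computation of c.\<close>

lemma wp_first_multiple:
  assumes R: "R 0 = int n" "R 3 = int q"
    and n: "1 \<le> n" and q: "prime q" "q < 2 ^ j"
    and V: "int q * int q + int q * int n + int n \<le> V" "V < 2 ^ w"
    and Q: "\<And>t' R' c. t' \<le> t + 8 * j + 8 \<Longrightarrow> 0 < c \<Longrightarrow> c \<le> int q * int n \<Longrightarrow>
       [c = 1] (mod int n) \<Longrightarrow> (int q dvd c \<longleftrightarrow> \<not> q dvd n) \<Longrightarrow>
       (\<And>i. i \<notin> {5, 8, 9, 10, 11} \<Longrightarrow> R' i = R i) \<Longrightarrow> R' 5 = c \<Longrightarrow> Q t' (R', m)"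
  shows "wp w first_multiple_com Q t (R, m)"
proof -
  have q2: "2 \<le> q" using q(1) by (rule prime_ge_2_nat)
  have fit: "fits w x" if "\<bar>x\<bar> \<le> V" for x
    using that V unfolding fits_def by linarith
  have qq: "2 * int q \<le> int q * int q" using q2 by (intro mult_right_mono) auto
  have qn: "0 \<le> int q * int n" by simp
  have fq: "fits w x" if "- int q \<le> x" "x \<le> int q" for x
    using that V qq qn by (intro fit) linarith
  have fq1: "fits w 0" "fits w 1" "fits w 2" "fits w (int q)" "fits w (int q - 2)"
    using q2 by (auto intro!: fq)
  have fn: "fits w (int n)" using V qq qn by (intro fit) linarith
  have m: "0 \<le> x mod int q" "x mod int q < int q" for x using q2 by auto
  have fm: "fits w (x mod int q)" for x
    using m[of x] by (intro fq) linarith+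
  have qqV: "int q * int q \<le> V" using V qn by linarith
  have "wp w power_loop
    (wp w (Seq (Arith 5 SUB (Const 0) (Reg 8)) (Seq (Arith 5 MOD (Reg 5) (Reg 3)) (Seq
      (Arith 5 MUL (Reg 5) (Reg 0)) (Arith 5 ADD (Reg 5) (Const 1))))) Q)
    (t + 3) (R(8 := 1, 9 := int n mod int q, 10 := int q - 2), m)"
  proof (rule wp_power_loop[where q = "int q" and b = "int n mod int q" and e = "q - 2" and V = V])
    fix t' r x y z
    assume t': "t' \<le> t + 3 + 8 * j + 1" and r: "0 \<le> r" "r < int q"
      "[r = (int n mod int q) ^ (q - 2)] (mod int q)"
    note c = first_multiple[OF q(1) n r(3)]
    have "fits w (- r)" "fits w r" using r by (auto intro!: fq)
    moreover have "(- r) mod int q * int n \<le> int q * int n"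
      using m[of "-r"] by (intro mult_right_mono) auto
    then have "(- r) mod int q * int n \<le> V" using V qq by linarith
    then have "fits w ((- r) mod int q * int n)"
      using m[of "-r"] by (intro fit) (simp add: abs_mult)
    moreover have "fits w ((- r) mod int q * int n + 1)"
      using V qq c(1,2) by (intro fit) linarith
    ultimately show "wp w (Seq (Arith 5 SUB (Const 0) (Reg 8)) (Seq (Arith 5 MOD (Reg 5) (Reg 3)) (Seq
      (Arith 5 MUL (Reg 5) (Reg 0)) (Arith 5 ADD (Reg 5) (Const 1))))) Q t'
      (R(8 := 1, 9 := int n mod int q, 10 := int q - 2, 8 := r, 9 := x, 10 := y, 11 := z), m)"
      using R q2 fq1 fm fn t' c by (auto intro!: Q split: if_splits)
  qed (use R q q2 V qqV m in auto)
  then show ?thesis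
    unfolding first_multiple_com_def using R q2 fq1 fm fn by (simp add: add_numeral_Suc)
qed

text \<open>The first pass marks q itself, and the second one may do so too if q is congruent to 1
  modulo n; the final \<open>Store\<close> unmarks it. The test on register 6 asks whether q divides
  c, that is, whether q does not divide n.\<close>

definition sieve_prime :: com where
  "sieve_prime = Seq
     (Arith 5 ADD (Reg 3) (Const 0)) (Seq
     (Arith 6 ADD (Reg 3) (Const 0)) (Seq
     (Arith 7 ADD (Reg 12) (Const 0)) (Seq
     mark (Seq
     first_multiple_com (Seq
     (Arith 6 MOD (Reg 5) (Reg 3)) (Seq
     (IF (Equal (Reg 6) (Const 0)) (Seq
       (Arith 6 MUL (Reg 3) (Reg 0)) (Seq
       (Arith 7 ADD (Reg 2) (Const 0))
       mark)) SKIP)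
     (Store (Reg 3) (Const 0))))))))"

text \<open>One call advances the sieve from q to q + 1. The instructions outside the marking rounds
  and the exponentiation rounds take at most 24 time units, counting 4 for each call of
  \<open>mark\<close> as its bound does.\<close>

lemma wp_sieve_prime:
  assumes R: "R 0 = int n" "R 12 = int N" "R 2 = int N * int N" "R 3 = int q"
    and n: "1 \<le> n" "n \<le> N" and q: "prime q" "q < N" and j: "N \<le> 2 ^ j"
    and V: "int N * int N + int N * int n + 1 \<le> V" "V < 2 ^ w"
    and Q: "\<And>t' R'. t' \<le> t + 25 + 8 * j + 3 * (N div q) + 3 * (N * N div (q * n)) \<Longrightarrow>
       (\<And>i. i \<in> {0, 2, 3, 12} \<Longrightarrow> R' i = R i) \<Longrightarrow> Q t' (R', sieve_memory n N (Suc q))"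
  shows "wp w sieve_prime Q t (R, sieve_memory n N q)"
proof -
  have q2: "2 \<le> q" using q(1) by (rule prime_ge_2_nat)
  have fit: "fits w x" if "\<bar>x\<bar> \<le> V" for x
    using that V unfolding fits_def by linarith
  have N2: "2 * int N \<le> int N * int N" using q q2 by (intro mult_right_mono) auto
  have Nn: "1 \<le> int N * int n" "0 \<le> int N * int N"
    using n q mult_mono[of 1 "int N" 1 "int n"] by auto
  have qN: "int q * int n \<le> int N * int n" "int q * int q \<le> int N * int N"
    using q by (auto intro!: mult_mono)
  have fN: "fits w x" if "- int N \<le> x" "x \<le> int N" for x
    using that V N2 Nn by (intro fit) linarith
  have base: "fits w (int q)" "fits w 0" "fits w (int N)" "fits w (int n)"
    using q n by (auto intro!: fN)
  have "int q * int n \<le> V" "int N * int N \<le> V" using V qN Nn by linarith+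
  then have base': "fits w (int q * int n)" "fits w (int N * int N)"
    by (auto intro!: fit simp: abs_mult)
  \<comment> \<open>\<open>m1\<close> and \<open>m2 c\<close> are the memories after the first and
    the second pass, before the cell of q is reset.\<close>
  define m1 where "m1 = (\<lambda>a. if int q \<le> a \<and> int q dvd a - int q \<and> a < int N then 1
    else sieve_memory n N q a)"
  define m2 where "m2 c = (\<lambda>a. if c \<le> a \<and> int q * int n dvd a - c \<and> a < int N * int N then 1
    else m1 a)" for c
  have dvd_shift: "int q dvd a - int q \<longleftrightarrow> int q dvd a" for a
    by (metis diff_add_cancel dvd_add_left_iff dvd_refl)
  have m1: "m1(int q := 0) = sieve_memory n N (Suc q)" if "q dvd n"
    using sieved_self[OF q2 q(2)] q not_cong_1_of_dvd[OF q(1) that]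
    unfolding m1_def sieve_memory_def dvd_shift by (auto simp: fun_eq_iff sieved_Suc_prime)
  have m2: "(m2 c)(int q := 0) = sieve_memory n N (Suc q)"
    if c: "\<not> q dvd n" "0 < c" "c \<le> int q * int n" "[c = 1] (mod int n)" "int q dvd c" for c
  proof
    fix a
    have prog: "c \<le> a \<and> int q * int n dvd a - c \<and> a < int N * int N \<longleftrightarrow>
        0 < a \<and> int q dvd a \<and> [a = 1] (mod int n) \<and> a < int N * int N"
      using progression_multiples[OF q(1) c, of a] by blast
    \<comment> \<open>A positive multiple of q other than q exceeds q, so the marked cells meet the
      condition \<open>int p < a\<close> in \<open>sieved\<close>.\<close>
    have "m2 c a = (if sieved n N (Suc q) a then 1 else 0)" if "a \<noteq> int q"
      unfolding m2_def m1_def sieve_memory_def dvd_shift prog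
      using that q zdvd_imp_le[of "int q" a] by (auto simp: sieved_Suc_prime)
    moreover have "\<not> sieved n N (Suc q) (int q)"
      using sieved_self[OF q2 q(2)] q by (simp add: sieved_Suc_prime)
    ultimately show "((m2 c)(int q := 0)) a = sieve_memory n N (Suc q) a"
      by (simp add: sieve_memory_def)
  qed
  have "wp w mark (wp w (Seq
     first_multiple_com (Seq
     (Arith 6 MOD (Reg 5) (Reg 3)) (Seq
     (IF (Equal (Reg 6) (Const 0)) (Seq
       (Arith 6 MUL (Reg 3) (Reg 0)) (Seq
       (Arith 7 ADD (Reg 2) (Const 0))
       mark)) SKIP)
     (Store (Reg 3) (Const 0))))) Q) (t + 3) (R(5 := int q, 6 := int q, 7 := int N), sieve_memory n N q)"
  proof (rule wp_mark[where c = "int q" and d = "int q" and B = "int N" and V = V])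
    fix t' x
    assume t': "t' \<le> t + 3 + 3 * nat (int N div int q) + 4"
    have "wp w first_multiple_com (wp w (Seq
     (Arith 6 MOD (Reg 5) (Reg 3)) (Seq
     (IF (Equal (Reg 6) (Const 0)) (Seq
       (Arith 6 MUL (Reg 3) (Reg 0)) (Seq
       (Arith 7 ADD (Reg 2) (Const 0))
       mark)) SKIP)
     (Store (Reg 3) (Const 0)))) Q) t' (R(5 := x, 6 := int q, 7 := int N), m1)"
    proof (rule wp_first_multiple[where n = n and q = q and j = j and V = V])
      fix t'' R' c
      assume t'': "t'' \<le> t' + 8 * j + 8" and c: "0 < c" "c \<le> int q * int n" "[c = 1] (mod int n)"
          "int q dvd c \<longleftrightarrow> \<not> q dvd n"
        and R': "\<And>i. i \<notin> {5, 8, 9, 10, 11} \<Longrightarrow> R' i = (R(5 := x, 6 := int q, 7 := int N)) i" "R' 5 = c"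
      have t'': "t'' \<le> t + 15 + 8 * j + 3 * (N div q)"
        using t' t'' by (simp flip: zdiv_int)
      have R'': "R' 0 = int n" "R' 2 = int N * int N" "R' 3 = int q" "R' 12 = int N"
        using R R' by auto
      have "0 \<le> c mod int q" "c mod int q < int q" using q2 by auto
      moreover have "c \<le> V" using c(2) qN V Nn by linarith
      ultimately have fc: "fits w (c mod int q)" "fits w c"
        using c(1) q by (auto intro: fN fit)
      show "wp w (Seq
         (Arith 6 MOD (Reg 5) (Reg 3)) (Seq
         (IF (Equal (Reg 6) (Const 0)) (Seq
           (Arith 6 MUL (Reg 3) (Reg 0)) (Seq
           (Arith 7 ADD (Reg 2) (Const 0))
           mark)) SKIP)
         (Store (Reg 3) (Const 0)))) Q t'' (R', m1)"
      proof (cases "q dvd n")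
        case True
        with c have "c mod int q \<noteq> 0" by auto
        moreover have "Q (t'' + 4) (R'(6 := c mod int q), m1(int q := 0))"
          unfolding m1[OF True] using t'' by (intro Q) (auto simp: R R'')
        ultimately show ?thesis
          using base fc q2 by (simp add: R'' R'(2) add_numeral_Suc)
      next
        case False
        with c have qc: "int q dvd c" by simp
        have "wp w mark (wp w (Store (Reg 3) (Const 0)) Q) (t'' + 4)
          (R'(6 := int q * int n, 7 := int N * int N), m1)"
        proof (rule wp_mark[where c = c and d = "int q * int n" and B = "int N * int N" and V = V])
          fix u y
          assume "u \<le> t'' + 4 + 3 * nat (int N * int N div (int q * int n)) + 4"
          also have "nat (int N * int N div (int q * int n)) = N * N div (q * n)"
            by (metis nat_int of_nat_mult zdiv_int)
          finally have "Q (u + 1) (R'(6 := int q * int n, 7 := int N * int N, 5 := y), (m2 c)(int q := 0))"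
            unfolding m2[OF False c(1-3) qc] using t'' by (intro Q) (auto simp: R R'')
          then show "wp w (Store (Reg 3) (Const 0)) Q u
            (R'(6 := int q * int n, 7 := int N * int N, 5 := y),
             \<lambda>a. if c \<le> a \<and> int q * int n dvd a - c \<and> a < int N * int N then 1 else m1 a)"
            using base by (simp add: R'' m2_def)
        next
          show "c \<le> int N * int N + int q * int n" "int N * int N + int q * int n \<le> V"
            using c(2) V Nn qN by linarith+
        qed (use R' c q2 n V Nn in auto)
        then show ?thesis
          using base base' fc q2 qc by (simp add: R'' R'(2) add_numeral_Suc)
      qed
    next
      have "(int q + 1) * int n \<le> int N * int n" using q by (intro mult_right_mono) auto
      then have "int q * int n + int n \<le> int N * int n" by (simp add: distrib_right)
      then show "int q * int q + int q * int n + int n \<le> V"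
        using V qN by linarith
    qed (use R n q j V in auto)
    then show "wp w (Seq
     first_multiple_com (Seq
     (Arith 6 MOD (Reg 5) (Reg 3)) (Seq
     (IF (Equal (Reg 6) (Const 0)) (Seq
       (Arith 6 MUL (Reg 3) (Reg 0)) (Seq
       (Arith 7 ADD (Reg 2) (Const 0))
       mark)) SKIP)
     (Store (Reg 3) (Const 0))))) Q t'
     (R(5 := int q, 6 := int q, 7 := int N, 5 := x),
      \<lambda>a. if int q \<le> a \<and> int q dvd a - int q \<and> a < int N then 1 else sieve_memory n N q a)"
      by (simp add: m1_def fun_upd_twist)
  next
    show "int N + int q \<le> V" using q V Nn N2 by linarith
  qed (use q q2 V in auto)
  then show ?thesis
    unfolding sieve_prime_def using base by (simp add: R add_numeral_Suc)
qed

definition sieve_loop :: com where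
  "sieve_loop = WHILE (Less (Reg 3) (Reg 12)) (Seq
     (Load 4 (Reg 3)) (Seq
     (IF (Equal (Reg 4) (Const 0)) sieve_prime SKIP)
     (Arith 3 ADD (Reg 3) (Const 1))))"

text \<open>A generous upper bound: 30 covers the 25 from \<open>wp_sieve_prime\<close> and the four
  instructions of the loop around it. Charging 8 * j to composite q as well adds only O(N * j) over
  the whole loop.\<close>

definition step_cost :: "nat \<Rightarrow> nat \<Rightarrow> nat \<Rightarrow> nat \<Rightarrow> nat" where
  "step_cost n N j q = 30 + 8 * j + (if prime q then 3 * (N div q) + 3 * (N * N div (q * n)) else 0)"

lemma wp_sieve_loop:
  assumes R: "R 0 = int n" "R 12 = int N" "R 2 = int N * int N" "R 3 = 2"
    and n: "1 \<le> n" "n \<le> N" and N: "2 \<le> N" and j: "N \<le> 2 ^ j"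
    and V: "int N * int N + int N * int n + 1 \<le> V" "V < 2 ^ w"
    and Q: "\<And>t' R'. t' \<le> t + (\<Sum>q=2..<N. step_cost n N j q) + 1 \<Longrightarrow>
       (\<And>i. i \<in> {0, 2, 12} \<Longrightarrow> R' i = R i) \<Longrightarrow> Q t' (R', sieve_memory n N N)"
  shows "wp w sieve_loop Q t (R, \<lambda>_. 0)"
proof -
  define T where "T = t + (\<Sum>q=2..<N. step_cost n N j q)"
  define I where "I t' s \<longleftrightarrow> (\<exists>q R'. s = (R', sieve_memory n N q) \<and> 2 \<le> q \<and> q \<le> N \<and>
     t' \<le> t + (\<Sum>q=2..<q. step_cost n N j q) \<and> R' 3 = int q \<and> (\<forall>i\<in>{0, 2, 12}. R' i = R i))" for t' s
  have N2: "2 * int N \<le> int N * int N" using N by (intro mult_right_mono) auto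
  have Nn: "0 \<le> int N * int n" "0 \<le> int N * int N" by auto
  have fN: "fits w x" if "- int N \<le> x" "x \<le> int N" for x
    unfolding fits_def using that V N2 Nn by linarith
  show ?thesis
    unfolding sieve_loop_def
  proof (rule wp_WHILE[where I = I and T = T])
    have "sieve_memory n N 2 = (\<lambda>_. 0)"
      unfolding sieve_memory_def sieved_def by (auto dest: prime_ge_2_nat simp: fun_eq_iff)
    then show "I t (R, \<lambda>_. 0)"
      unfolding I_def using R N by (intro exI[of _ 2]) auto
  next
    fix t' s assume "I t' s"
    then obtain q R' where s: "s = (R', sieve_memory n N q)" and q: "2 \<le> q" "q \<le> N"
      and t': "t' \<le> t + (\<Sum>q=2..<q. step_cost n N j q)"
      and R': "R' 3 = int q" "\<forall>i\<in>{0, 2, 12}. R' i = R i"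
      unfolding I_def by blast
    have R'': "R' 0 = int n" "R' 12 = int N" "R' 2 = int N * int N" using R R' by auto
    have base: "fits w (int q)" "fits w 0" "fits w 1" "fits w (int N)"
      using q by (auto intro!: fN)
    show "test_fits w s (Less (Reg 3) (Reg 12))"
      using base by (simp add: s R' R'')
    have "(\<Sum>q=2..<q. step_cost n N j q) \<le> (\<Sum>q=2..<N. step_cost n N j q)"
      using q by (intro sum_mono2) auto
    then show "t' \<le> T" using t' unfolding T_def by linarith
    { assume "holds s (Less (Reg 3) (Reg 12))"
      then have qN: "q < N" by (simp add: s R' R'')
      have fq1: "fits w (int q + 1)" using qN by (auto intro!: fN)
      have self: "sieve_memory n N q (int q) = (if prime q then 0 else 1)"
        unfolding sieve_memory_def using sieved_self[OF q(1) qN] by simp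
      have Inv: "I u (R1(3 := int q + 1), sieve_memory n N (Suc q))"
        if "u \<le> t' + step_cost n N j q" "\<And>i. i \<in> {0, 2, 12} \<Longrightarrow> R1 i = R' i" for u R1
        unfolding I_def using that t' q qN R'
        by (intro exI[of _ "Suc q"] exI[of _ "R1(3 := int q + 1)"]) auto
      show "wp w (Seq (Load 4 (Reg 3)) (Seq (IF (Equal (Reg 4) (Const 0)) sieve_prime SKIP)
         (Arith 3 ADD (Reg 3) (Const 1)))) I (Suc t') s"
      proof (cases "prime q")
        case False
        have "I (Suc (Suc (Suc (Suc (Suc t'))))) ((R'(4 := 1))(3 := int q + 1), sieve_memory n N (Suc q))"
          by (rule Inv) (auto simp: step_cost_def)
        with False show ?thesis
          using base fq1 by (simp add: s R' self sieve_memory_Suc_not_prime)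
      next
        case True
        have "wp w sieve_prime (wp w (Arith 3 ADD (Reg 3) (Const 1)) I) (Suc (Suc (Suc t')))
          (R'(4 := 0), sieve_memory n N q)"
        proof (rule wp_sieve_prime[OF _ _ _ _ n True qN j V])
          fix u R1
          assume u: "u \<le> Suc (Suc (Suc t')) + 25 + 8 * j + 3 * (N div q) + 3 * (N * N div (q * n))"
            and R1: "\<And>i. i \<in> {0, 2, 3, 12} \<Longrightarrow> R1 i = (R'(4 := 0)) i"
          have "I (u + 1) (R1(3 := int q + 1), sieve_memory n N (Suc q))"
            by (rule Inv) (use u R1 True in \<open>auto simp: step_cost_def\<close>)
          then show "wp w (Arith 3 ADD (Reg 3) (Const 1)) I u (R1, sieve_memory n N (Suc q))"
            using R1 base fq1 by (simp add: R')
        qed (simp_all add: R' R'')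
        with True show ?thesis
          using base by (simp add: s R' self)
      qed }
    { assume "\<not> holds s (Less (Reg 3) (Reg 12))"
      then have "q = N" using q by (simp add: s R' R'')
      then show "Q (Suc t') s"
        unfolding s using t' R' by (auto intro!: Q) }
  qed
qed


section \<open>The complete program\<close>

text \<open>The walk starts at 1 + n, since the cell of 1 is never marked.\<close>

definition search :: com where
  "search = Seq
     (Arith 5 ADD (Reg 0) (Const 1)) (Seq
     (Load 4 (Reg 5)) (Seq
     (WHILE (Less (Const 0) (Reg 4)) (Seq
       (Arith 5 ADD (Reg 5) (Reg 0))
       (Load 4 (Reg 5))))
     (Arith 0 ADD (Reg 5) (Const 0))))"

text \<open>The number 1 + K * n is a prime known to exist, and its cell is unmarked. The search
  therefore stops there at the latest, so the program needs no bound check, and the prime it returns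
  inherits the bound on 1 + K * n.\<close>

lemma wp_search:
  assumes R: "R 0 = int n" and n: "1 \<le> n"
    and K: "prime (1 + K * n)" "1 + K * n < N * N"
    and V: "N * N < 2 ^ w"
    and Q: "\<And>t' R' p. t' \<le> t + 3 * K + 4 \<Longrightarrow> prime p \<Longrightarrow> p \<le> 1 + K * n \<Longrightarrow> [p = 1] (mod n) \<Longrightarrow>
      R' 0 = int p \<Longrightarrow> Q t' (R', sieve_memory n N N)"
  shows "wp w search Q t (R, sieve_memory n N N)"
proof -
  let ?m = "sieve_memory n N N"
  have VV: "int N * int N < 2 ^ w" using V by (metis of_nat_less_iff of_nat_mult of_nat_numeral of_nat_power)
  have fit: "fits w (int x)" if "x \<le> N * N" for x
    using that V unfolding fits_def by (metis abs_of_nat le_less_trans of_nat_less_iff of_nat_numeral of_nat_power)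
  have fm: "fits w (?m a)" for a
  proof -
    have "1 \<le> N * N" using K(2) by linarith
    then show ?thesis using fit[of 0] fit[of 1] by (simp add: sieve_memory_def)
  qed
  have K1: "1 \<le> K" using K(1) by (cases K) auto
  have unmarked: "?m (int (1 + k * n)) = 0 \<longleftrightarrow> prime (1 + k * n)" if "1 \<le> k" "k \<le> K" for k
  proof -
    have "k * n \<le> K * n" "1 \<le> k * n" using that n by auto
    then have "2 \<le> 1 + k * n" "1 + k * n < N * N" using K(2) by linarith+
    moreover have "[1 + k * n = 1] (mod n)" unfolding cong_def by (rule mod_mult_self1)
    ultimately show ?thesis
      using sieved_square[of "1 + k * n" N n N] by (simp add: sieve_memory_def)
  qed
  have kn: "1 + k * n \<le> N * N" if "k \<le> K" for k
    using that K(2) mult_right_mono[of k K n] by linarith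
  define I where "I t' s \<longleftrightarrow> (\<exists>k (R' :: nat \<Rightarrow> int). s = (R', ?m) \<and> 1 \<le> k \<and> k \<le> K \<and> t' + 1 = t + 3 * k \<and> R' 0 = int n \<and>
    R' 5 = int (1 + k * n) \<and> R' 4 = ?m (int (1 + k * n)))" for t' s
  have "wp w (WHILE (Less (Const 0) (Reg 4)) (Seq
       (Arith 5 ADD (Reg 5) (Reg 0))
       (Load 4 (Reg 5)))) (wp w (Arith 0 ADD (Reg 5) (Const 0)) Q) (t + 2)
       (R(5 := int (1 + n), 4 := ?m (int (1 + n))), ?m)"
  proof (rule wp_WHILE[where I = I and T = "t + 3 * K"])
    show "I (t + 2) (R(5 := int (1 + n), 4 := ?m (int (1 + n))), ?m)"
      unfolding I_def using R K1
      by (intro exI[of _ 1] exI[of _ "R(5 := int (1 + n), 4 := ?m (int (1 + n)))"]) auto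
  next
    fix t' s assume "I t' s"
    then obtain k R' where s: "s = (R', ?m)" and k: "1 \<le> k" "k \<le> K" and t': "t' + 1 = t + 3 * k"
      and R': "R' 0 = int n" "R' 5 = int (1 + k * n)" "R' 4 = ?m (int (1 + k * n))"
      unfolding I_def by blast
    show "test_fits w s (Less (Const 0) (Reg 4))"
      using fit[of 0] by (simp add: s R' fm del: of_nat_Suc of_nat_add of_nat_mult)
    show "t' \<le> t + 3 * K" using t' k by linarith
    have fk: "fits w (int (1 + k * n))" "fits w (int n)"
      by (rule fit[OF kn[OF k(2)]]) (rule fit, use kn[OF K1] in simp)
    { assume "holds s (Less (Const 0) (Reg 4))"
      then have "?m (int (1 + k * n)) \<noteq> 0" by (simp add: s R')
      then have kK: "k < K" using unmarked[OF k] K(1) k by (metis le_neq_implies_less)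
      have fk': "fits w (int (1 + Suc k * n))" using kK by (intro fit kn) auto
      have "I (Suc (Suc (Suc t'))) (R'(5 := int (1 + Suc k * n), 4 := ?m (int (1 + Suc k * n))), ?m)"
        unfolding I_def using kK k t' R'
        by (intro exI[of _ "Suc k"] exI[of _ "R'(5 := int (1 + Suc k * n), 4 := ?m (int (1 + Suc k * n)))"]) auto
      then show "wp w (Seq (Arith 5 ADD (Reg 5) (Reg 0)) (Load 4 (Reg 5))) I (Suc t') s"
        using fk fk' by (simp add: s R' fm algebra_simps) }
    { assume "\<not> holds s (Less (Const 0) (Reg 4))"
      then have "?m (int (1 + k * n)) = 0"
        by (simp add: s R' sieve_memory_def split: if_splits)
      then have p: "prime (1 + k * n)" using unmarked[OF k] by simp
      have "Q (Suc (Suc t')) (R'(0 := int (1 + k * n)), ?m)"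
      proof (rule Q[where p = "1 + k * n"])
        show "[1 + k * n = 1] (mod n)" unfolding cong_def by (rule mod_mult_self1)
      qed (use p t' k in auto)
      then show "wp w (Arith 0 ADD (Reg 5) (Const 0)) Q (Suc t') s"
        using fk fit[of 0] by (simp add: s R') }
  qed
  moreover have "fits w 1"
  proof -
    have "1 \<le> N * N" using kn[OF K1] by linarith
    then show ?thesis using fit[of 1] by simp
  qed
  moreover have "fits w (int (1 + n))" "fits w (int n)" "fits w 0"
    using fit[of "1 + n"] fit[of n] fit[of 0] kn[OF K1] by auto
  ultimately show ?thesis
    unfolding search_def using R by (simp add: fm add.commute)
qed

text \<open>Halving n down to 0 counts its bit length L in register 4, which relies on that register
  being 0 at the start.\<close>

definition setup_com :: com where
  "setup_com = Seq
     (Arith 5 ADD (Reg 0) (Const 0)) (Seq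
     (WHILE (Less (Const 0) (Reg 5)) (Seq
       (Arith 5 DIV (Reg 5) (Const 2))
       (Arith 4 ADD (Reg 4) (Const 1)))) (Seq
     (Arith 12 MUL (Reg 0) (Reg 4)) (Seq
     (Arith 12 MUL (Reg 12) (Const 2)) (Seq
     (Arith 2 MUL (Reg 12) (Reg 12))
     (Arith 3 ADD (Const 2) (Const 0))))))"

lemma wp_setup:
  assumes R: "R 0 = int n" "R 4 = 0" and n: "1 \<le> n"
    and N: "N = 2 * n * floorlog 2 n" "N * N < 2 ^ w"
    and Q: "\<And>t' R'. t' \<le> t + 3 * floorlog 2 n + 6 \<Longrightarrow>
      R' 0 = int n \<Longrightarrow> R' 12 = int N \<Longrightarrow> R' 2 = int N * int N \<Longrightarrow> R' 3 = 2 \<Longrightarrow> Q t' (R', m)"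
  shows "wp w setup_com Q t (R, m)"
proof -
  have L: "1 \<le> floorlog 2 n" using n by (simp add: floorlog_def)
  have nN: "2 \<le> N" "n \<le> N" "floorlog 2 n \<le> N" "n * floorlog 2 n \<le> N"
    unfolding N(1) using n L mult_mono[of 1 n 1 "floorlog 2 n"] by auto
  have "N \<le> N * N" by simp
  have fit: "fits w (int x)" if "x \<le> N * N" for x
    using that N(2) unfolding fits_def by (metis abs_of_nat le_less_trans of_nat_less_iff of_nat_numeral of_nat_power)
  have fN: "fits w (int x)" if "x \<le> N" for x using that \<open>N \<le> N * N\<close> by (intro fit) linarith
  have base: "fits w 0" "fits w 1" "fits w 2" using fN[of 0] fN[of 1] fN[of 2] nN by auto
  define S where "S i = (R(5 := int (n div 2 ^ i), 4 := int i), m)" for i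
  define I where "I t' s \<longleftrightarrow> (\<exists>i. i \<le> floorlog 2 n \<and> s = S i \<and> t' = t + 1 + 3 * i)" for t' s
  have "wp w (WHILE (Less (Const 0) (Reg 5)) (Seq
       (Arith 5 DIV (Reg 5) (Const 2))
       (Arith 4 ADD (Reg 4) (Const 1))))
     (wp w (Seq (Arith 12 MUL (Reg 0) (Reg 4)) (Seq
     (Arith 12 MUL (Reg 12) (Const 2)) (Seq
     (Arith 2 MUL (Reg 12) (Reg 12))
     (Arith 3 ADD (Const 2) (Const 0))))) Q) (t + 1) (R(5 := int n), m)"
  proof (rule wp_WHILE[where I = I and T = "t + 1 + 3 * floorlog 2 n"])
    have "(R(5 := int n), m) = S 0" unfolding S_def using R by (auto simp: fun_eq_iff)
    then show "I (t + 1) (R(5 := int n), m)" unfolding I_def by auto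
  next
    fix t' s assume "I t' s"
    then obtain i where i: "i \<le> floorlog 2 n" and s: "s = S i" and t': "t' = t + 1 + 3 * i"
      unfolding I_def by blast
    have "n div 2 ^ i \<le> n" by (rule div_le_dividend)
    then have fits: "fits w (int (n div 2 ^ i))" "fits w (int i)" "fits w (int n)"
      "fits w (int (n div 2 ^ Suc i))"
      using nN i by (auto intro!: fN intro: order_trans[OF div_le_dividend])
    show "test_fits w s (Less (Const 0) (Reg 5))"
      using base fits by (simp add: s S_def)
    show "t' \<le> t + 1 + 3 * floorlog 2 n" using t' i by simp
    { assume "holds s (Less (Const 0) (Reg 5))"
      then have "n div 2 ^ i > 0" by (simp add: s S_def)
      then have "2 ^ i \<le> n" by (simp add: div_greater_zero_iff)
      then have i': "Suc i \<le> floorlog 2 n" by (intro floorlog_ge_SucI) auto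
      have fi: "fits w (int (Suc i))" using i' nN by (intro fN) linarith
      have "I (Suc (Suc (Suc t'))) (S (Suc i))"
        unfolding I_def using i' t' by (intro exI[of _ "Suc i"]) auto
      moreover have "S (Suc i) = ((R(5 := int (n div 2 ^ i), 4 := int i))(5 := int (n div 2 ^ i) div 2, 4 := int i + 1), m)"
        unfolding S_def by (auto simp: fun_eq_iff zdiv_int div_mult2_eq mult.commute[of 2])
      moreover have "int (n div 2 ^ i) div 2 = int (n div 2 ^ Suc i)"
        by (simp add: zdiv_int div_mult2_eq mult.commute[of 2])
      ultimately show "wp w (Seq (Arith 5 DIV (Reg 5) (Const 2)) (Arith 4 ADD (Reg 4) (Const 1))) I (Suc t') s"
        using base fits fi unfolding s by (simp add: S_def add.commute del: of_nat_div power_Suc) }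
    { assume "\<not> holds s (Less (Const 0) (Reg 5))"
      then have "n div 2 ^ i = 0" by (simp add: s S_def)
      then have "n < 2 ^ i" by (simp add: div_eq_0_iff)
      then have "floorlog 2 n \<le> i" by (intro floorlog_leI) auto
      then have i: "i = floorlog 2 n" using i by simp
      have N': "int n * int (floorlog 2 n) * 2 = int N" unfolding N(1) by simp
      have "fits w (int n * int (floorlog 2 n))" using fN[OF nN(4)] by simp
      moreover have "fits w (int N * int N)" using fit[of "N * N"] by simp
      moreover have "fits w (int N)" using fN[of N] by simp
      ultimately show "wp w (Seq (Arith 12 MUL (Reg 0) (Reg 4)) (Seq
          (Arith 12 MUL (Reg 12) (Const 2)) (Seq
          (Arith 2 MUL (Reg 12) (Reg 12))
          (Arith 3 ADD (Const 2) (Const 0))))) Q (Suc t') s"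
        using base fits R unfolding s
        by (simp add: S_def i N') (rule Q, simp_all add: t' i N' R) }
  qed
  then show ?thesis
    unfolding setup_com_def using R base fN[OF nN(2)] by simp
qed

definition find_prime :: com where
  "find_prime = Seq setup_com (Seq sieve_loop search)"

text \<open>Word length: n < 2^L and L <= 2^L give N <= 2^(2L+1), so N^2 <= 2^(4L+2), and two more
  bits make room for N^2 + N * n + 1. The 11 collects the constants 6, 1 and 4 of setup, sieve and
  search.\<close>

lemma exec_find_prime:
  assumes n: "2 \<le> n" and L: "L = floorlog 2 n" and N: "N = 2 * n * L"
    and K: "prime (1 + K * n)" "1 + K * n < N * N"
  shows "\<exists>t s p. exec (4 * L + 4) find_prime (input n) t s \<and> result s = int p \<and>
    t \<le> 3 * L + (\<Sum>q=2..<N. step_cost n N (2 * L + 1) q) + 3 * K + 11 \<and>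
    prime p \<and> p \<le> 1 + K * n \<and> [p = 1] (mod n)"
proof -
  have L1: "1 \<le> L" using n L by (simp add: floorlog_def)
  have nN: "n \<le> N" "2 \<le> N" using n L1 N mult_mono[of 1 n 1 L] by auto
  have "n < 2 ^ L" unfolding L using floorlog_bounds[of n 2] n by simp
  moreover have "L \<le> 2 ^ L" by (simp add: less_imp_le)
  ultimately have "n * L \<le> 2 ^ L * 2 ^ L" by (intro mult_mono) auto
  then have NJ: "N \<le> 2 ^ (2 * L + 1)" unfolding N by (simp add: power_add mult_2 distrib_right)
  have NN: "N * N \<le> 2 ^ (4 * L + 2)"
    using mult_mono[OF NJ NJ] by (simp flip: power_add)
  have Nn: "N * n \<le> N * N" using nN by simp
  have pw: "(2 :: nat) ^ (4 * L + 4) = 4 * 2 ^ (4 * L + 2)" by (simp add: power_add)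
  have V': "N * N + N * n + 1 < 2 ^ (4 * L + 4)"
    using NN Nn nN mult_mono[of 1 N 1 N] unfolding pw by linarith
  then have V: "int N * int N + int N * int n + 1 < 2 ^ (4 * L + 4)"
  proof -
    have "int (N * N + N * n + 1) < int (2 ^ (4 * L + 4))" using V' by (simp only: of_nat_less_iff)
    then show ?thesis by (simp only: of_nat_add of_nat_mult of_nat_power of_nat_numeral of_nat_1)
  qed
  define Q where "Q t s \<longleftrightarrow> (\<exists>p. result s = int p \<and>
    t \<le> 3 * L + (\<Sum>q=2..<N. step_cost n N (2 * L + 1) q) + 3 * K + 11 \<and>
    prime p \<and> p \<le> 1 + K * n \<and> [p = 1] (mod n))" for t s
  have "wp (4 * L + 4) setup_com (wp (4 * L + 4) (Seq sieve_loop search) Q) 0 ((\<lambda>_. 0)(0 := int n), \<lambda>_. 0)"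
  proof (rule wp_setup[where n = n and N = N])
    fix t and R :: "nat \<Rightarrow> int"
    assume t: "t \<le> 0 + 3 * floorlog 2 n + 6"
      and R: "R 0 = int n" "R 12 = int N" "R 2 = int N * int N" "R 3 = 2"
    have "wp (4 * L + 4) sieve_loop (wp (4 * L + 4) search Q) t (R, \<lambda>_. 0)"
    proof (rule wp_sieve_loop[OF R _ nN NJ order_refl V])
      fix t' and R' :: "nat \<Rightarrow> int"
      assume t': "t' \<le> t + (\<Sum>q=2..<N. step_cost n N (2 * L + 1) q) + 1"
        and R': "\<And>i. i \<in> {0, 2, 12} \<Longrightarrow> R' i = R i"
      show "wp (4 * L + 4) search Q t' (R', sieve_memory n N N)"
      proof (rule wp_search[OF _ _ K])
        fix u p and R'' :: "nat \<Rightarrow> int"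
        assume "u \<le> t' + 3 * K + 4" "prime p" "p \<le> 1 + K * n" "[p = 1] (mod n)" "R'' 0 = int p"
        then show "Q u (R'', sieve_memory n N N)"
          unfolding Q_def result_def using t t' L by (intro exI[of _ p]) auto
      qed (use R R' n V' in auto)
    qed (use n in auto)
    then show "wp (4 * L + 4) (Seq sieve_loop search) Q t (R, \<lambda>_. 0)" by simp
  qed (use n N L V' in auto)
  then have "wp (4 * L + 4) find_prime Q 0 (input n)"
    unfolding find_prime_def input_def by simp
  then show ?thesis unfolding wp_def Q_def by auto
qed


section \<open>Running time\<close>

text \<open>The prime-dependent costs are at most 3 * (N + N^2 / n) / q, so they sum to a multiple
  of the sum of 1/q, which is at most 4 * \<open>harm J\<close>.\<close>

lemma sum_step_cost_le:
  assumes n: "1 \<le> n" and NJ: "N \<le> 2 ^ J"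
  shows "real (\<Sum>q=2..<N. step_cost n N J q) \<le>
    real N * (30 + 8 * real J) + 12 * (real N + real N * real N / real n) * harm J"
proof -
  let ?B = "3 * (real N + real N * real N / real n)"
  have "real (step_cost n N J q) \<le> 30 + 8 * real J + (if prime q then ?B * (1 / real q) else 0)"
    if "q \<in> {2..<N}" for q
  proof -
    have "real (N div q) \<le> real N / real q" by (rule of_nat_div_le_of_nat)
    moreover have "real (N * N div (q * n)) \<le> real (N * N) / real (q * n)"
      by (rule of_nat_div_le_of_nat)
    moreover have "?B * (1 / real q) = 3 * (real N / real q) + 3 * (real (N * N) / real (q * n))"
      using n that by (simp add: field_simps)
    ultimately show ?thesis by (simp add: step_cost_def)
  qed
  then have "real (\<Sum>q=2..<N. step_cost n N J q) \<le>
      (\<Sum>q=2..<N. 30 + 8 * real J + (if prime q then ?B * (1 / real q) else 0))"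
    unfolding of_nat_sum by (rule sum_mono)
  also have "\<dots> = real (N - 2) * (30 + 8 * real J) + ?B * (\<Sum>q | q \<in> {2..<N} \<and> prime q. 1 / real q)"
    by (simp add: sum.distrib sum_distrib_left sum.inter_filter[symmetric])
  also have "(\<Sum>q | q \<in> {2..<N} \<and> prime q. 1 / real q) \<le> (\<Sum>q | prime q \<and> q \<le> 2 ^ J. 1 / real q)"
    using NJ by (intro sum_mono2) (auto intro: finite_subset[of _ "{..2 ^ J}"])
  also have "\<dots> \<le> 4 * harm J" by (rule sum_inverse_primes_le_harm)
  finally have "real (\<Sum>q=2..<N. step_cost n N J q) \<le> real (N - 2) * (30 + 8 * real J) + ?B * (4 * harm J)"
    by (auto simp: mult_left_mono)
  also have "real (N - 2) * (30 + 8 * real J) \<le> real N * (30 + 8 * real J)"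
    by (intro mult_right_mono) auto
  finally show ?thesis by (simp add: algebra_simps)
qed

text \<open>With N = 2nL one has N^2 / n = 4nL^2, so everything is measured in X = nL^2 and X * h,
  where h bounds the harmonic number. The sieve costs at most 108 X + 72 X h, the remaining terms 3
  X, 6 X and 11 X, in total at most 200 X h.\<close>

lemma find_prime_cost_le:
  assumes n: "1 \<le> n" and L: "1 \<le> L" "n < 2 ^ L" and N: "N = 2 * n * L" and K: "K \<le> 2 * n * L\<^sup>2"
  shows "real (3 * L + (\<Sum>q=2..<N. step_cost n N (2 * L + 1) q) + 3 * K + 11) \<le>
    200 * real n * (real L)\<^sup>2 * (1 + ln (2 * real L + 1))"
proof -
  define X where "X = real n * (real L)\<^sup>2"
  define h where "h = 1 + ln (2 * real L + 1)"
  have h: "1 \<le> h" unfolding h_def using L by simp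
  have L2: "real L \<le> (real L)\<^sup>2" "1 \<le> (real L)\<^sup>2"
    using L one_le_power[of "real L" 2] by (auto simp: power2_eq_square)
  have X: "real n * real L \<le> X" "real L \<le> X" "1 \<le> X"
    unfolding X_def using n L L2 mult_mono[of 1 "real n" "real L" "(real L)\<^sup>2"] mult_mono[of 1 "real n" 1 "(real L)\<^sup>2"]
    by (auto intro: mult_left_mono)
  have "L \<le> 2 ^ L" by (simp add: less_imp_le)
  then have "n * L \<le> 2 ^ L * 2 ^ L" using L by (intro mult_mono) auto
  then have "N \<le> 2 ^ (2 * L + 1)" unfolding N by (simp add: power_add mult_2 distrib_right)
  from sum_step_cost_le[OF n this]
  have "real (\<Sum>q=2..<N. step_cost n N (2 * L + 1) q) \<le>
    real N * (30 + 8 * real (2 * L + 1)) + 12 * (real N + real N * real N / real n) * harm (2 * L + 1)" .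
  also have "real N * (30 + 8 * real (2 * L + 1)) = 76 * (real n * real L) + 32 * X"
    by (simp add: N X_def power2_eq_square algebra_simps)
  also have "real N + real N * real N / real n = 2 * (real n * real L) + 4 * X"
    using n by (simp add: N X_def power2_eq_square field_simps)
  also have "12 * (2 * (real n * real L) + 4 * X) * harm (2 * L + 1) \<le> 12 * (2 * X + 4 * X) * h"
    using harm_le_ln[of "2 * L + 1"] X h by (intro mult_mono add_mono) (auto simp: h_def add.commute intro: harm_nonneg)
  finally have "real (\<Sum>q=2..<N. step_cost n N (2 * L + 1) q) \<le> 108 * X + 72 * (X * h)"
    using X by simp
  moreover have "real K \<le> 2 * X"
    using K unfolding X_def by (metis (mono_tags) mult.assoc of_nat_le_iff of_nat_mult of_nat_numeral of_nat_power)
  moreover have "X \<le> X * h" using X h by simp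
  ultimately have "real (3 * L + (\<Sum>q=2..<N. step_cost n N (2 * L + 1) q) + 3 * K + 11) \<le> 200 * (X * h)"
    using X(2,3) by (simp only: of_nat_add of_nat_mult of_nat_numeral)
  then show ?thesis by (simp add: X_def h_def mult.assoc)
qed

theorem theorem10:
  assumes GRH: "generalized_riemann_hypothesis"
    and Bach_Sorenson: "\<And>m r :: nat. generalized_riemann_hypothesis \<Longrightarrow> 2 \<le> m \<Longrightarrow> gcd m r = 1 \<Longrightarrow>
      \<exists>q. prime q \<and> [q = r] (mod m) \<and> real q < 2 * (real m * ln (real m))\<^sup>2"
  shows "found_in_time {n. 2 \<le> n}
    (\<lambda>n p. prime p \<and> [p = 1] (mod n) \<and> real p < 2 * (real n * ln (real n))\<^sup>2)
    (\<lambda>n. real n * (ln (real n))\<^sup>2 * ln (ln (real n)))"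
proof -
  \<comment> \<open>The estimate of \<open>find_prime_cost_le\<close> with L replaced by its upper
    bound log_2 n + 1, so that only elementary functions of n remain.\<close>
  define bound where "bound n = 200 * real n * (log 2 (real n) + 1)\<^sup>2 * (1 + ln (2 * (log 2 (real n) + 1) + 1))" for n
  have floorlog_le: "real (floorlog 2 n) \<le> log 2 (real n) + 1" if "2 \<le> n" for n
    using that by (simp add: floorlog_def)
  have run: "\<exists>t. (\<exists>s p. exec (4 * floorlog 2 n + 4) find_prime (input n) t s \<and> result s = int p \<and>
      prime p \<and> [p = 1] (mod n) \<and> real p < 2 * (real n * ln (real n))\<^sup>2) \<and> real t \<le> bound n"
    if n: "2 \<le> n" for n
  proof -
    define L where "L = floorlog 2 n"
    define N where "N = 2 * n * L"
    have L1: "1 \<le> L" using n by (simp add: L_def floorlog_def)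
    have nL: "n < 2 ^ L" unfolding L_def using floorlog_bounds[of n 2] n by simp
    have "real n < 2 ^ L" using nL by (metis of_nat_less_iff of_nat_numeral of_nat_power)
    then have "ln (real n) \<le> real L * ln 2" using n by (subst ln_realpow[symmetric]) auto
    also have "\<dots> \<le> real L * 1" using ln_2_less_1 by (intro mult_left_mono) auto
    finally have lnL: "0 \<le> ln (real n)" "ln (real n) \<le> real L" using n by auto
    obtain q where q: "prime q" "[q = 1] (mod n)" "real q < 2 * (real n * ln (real n))\<^sup>2"
      using Bach_Sorenson[OF GRH n, of 1] by auto
    have "n dvd q - 1" using q(2) prime_gt_0_nat[OF q(1)] cong_altdef_nat[of 1 q n] by simp
    then obtain K where "q - 1 = n * K" by blast
    then have qK: "q = 1 + K * n" using prime_gt_0_nat[OF q(1)] by (simp add: mult.commute)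
    \<comment> \<open>Since ln n <= L, the Bach--Sorenson bound is at most 2 (nL)^2, which lies
      below N^2 = 4 (nL)^2. The known prime is thus within reach of the sieve.\<close>
    have "(real n * ln (real n))\<^sup>2 \<le> (real n * real L)\<^sup>2"
      using lnL by (intro power_mono mult_left_mono) auto
    with q(3) have "real q < real (2 * (n * L)\<^sup>2)" by simp
    then have qL: "q < 2 * (n * L)\<^sup>2" by (simp only: of_nat_less_iff)
    have "2 * (n * L)\<^sup>2 \<le> N * N" by (simp add: N_def power2_eq_square)
    with qL have qN: "q < N * N" by linarith
    \<comment> \<open>The same bound divided by n limits the length of the search.\<close>
    have "n * K \<le> 2 * (n * L)\<^sup>2" using qL qK by (simp add: mult.commute)
    also have "\<dots> = n * (2 * n * L\<^sup>2)" by (simp add: power2_eq_square)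
    finally have "n * K \<le> n * (2 * n * L\<^sup>2)" .
    then have K: "K \<le> 2 * n * L\<^sup>2" using n by simp
    obtain t s p where run: "exec (4 * L + 4) find_prime (input n) t s" "result s = int p"
      "t \<le> 3 * L + (\<Sum>q=2..<N. step_cost n N (2 * L + 1) q) + 3 * K + 11"
      "prime p" "p \<le> 1 + K * n" "[p = 1] (mod n)"
      using exec_find_prime[OF n L_def N_def] q(1) qN unfolding qK by blast
    \<comment> \<open>The prime found need not be q, but it is no larger.\<close>
    have "real p \<le> real q" using run(5) unfolding qK by (simp only: of_nat_le_iff)
    then have "real p < 2 * (real n * ln (real n))\<^sup>2" using q(3) by linarith
    moreover have "real t \<le> bound n"
    proof -
      have "real t \<le> real (3 * L + (\<Sum>q=2..<N. step_cost n N (2 * L + 1) q) + 3 * K + 11)"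
        using run(3) by (simp only: of_nat_le_iff)
      also have "\<dots> \<le> 200 * real n * (real L)\<^sup>2 * (1 + ln (2 * real L + 1))"
        using n by (intro find_prime_cost_le L1 nL N_def K) auto
      also have "\<dots> \<le> bound n"
        unfolding bound_def using floorlog_le[OF n] L1
        by (intro mult_mono add_mono power_mono) (auto simp: L_def)
      finally show ?thesis .
    qed
    ultimately show ?thesis using run unfolding L_def by blast
  qed
  \<comment> \<open>\<open>found_in_time\<close> asks for exact running times, so one is chosen for
    each n.\<close>
  then obtain time where time: "\<And>n. 2 \<le> n \<Longrightarrow> (\<exists>s p. exec (4 * floorlog 2 n + 4) find_prime (input n) (time n) s \<and>
      result s = int p \<and> prime p \<and> [p = 1] (mod n) \<and> real p < 2 * (real n * ln (real n))\<^sup>2) \<and>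
      real (time n) \<le> bound n"
    by metis
  have "(\<lambda>n. real (4 * floorlog 2 n + 4)) \<in> O(\<lambda>n. 4 * (log 2 (real n) + 1) + 4)"
    using floorlog_le
    by (intro bigoI[of _ 1] eventually_mono[OF eventually_ge_at_top[of 2]]) fastforce
  also have "(\<lambda>n::nat. 4 * (log 2 (real n) + 1) + 4) \<in> O(\<lambda>n. ln (real n))" by real_asymp
  finally have words: "(\<lambda>n. real (4 * floorlog 2 n + 4)) \<in> O(\<lambda>n. ln (real n))" .
  have "(\<lambda>n. real (time n)) \<in> O(bound)"
    using time by (intro bigoI[of _ 1] eventually_mono[OF eventually_ge_at_top[of 2]]) fastforce
  \<comment> \<open>The factor (log_2 n + 1)^2 has the order of (ln n)^2, and the last factor that
    of ln (ln n).\<close>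
  also have "bound \<in> O(\<lambda>n. real n * (ln (real n))\<^sup>2 * ln (ln (real n)))"
    unfolding bound_def by real_asymp
  finally show ?thesis
    unfolding found_in_time_def using words time
    by (intro exI[of _ find_prime] exI[of _ "\<lambda>n. 4 * floorlog 2 n + 4"] exI[of _ time]) auto
qed

end
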